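(* Let $q=2^s$ with $s>1$, $e>0$ an integer, and $n=(q-1)q^0+\frac q2 q^{e-1}+\frac q2 q^e$. Then, as polynomials, $g_{n,q}=x+\mathrm{Tr}_{q^e/q}(x)+x^{\frac12 q^e}\,\mathrm{Tr}_{q^e/q}(x)^{\frac12 q}$. When $e$ is odd, $g_{n,q}$ is a permutation polynomial of $\mathbb{F}_{q^e}$.
   Context: For a prime $p$, a power $q$ of $p$ and an integer $n\ge 0$, $g_{n,q}\in\mathbb{F}_p[x]$ is the unique polynomial with $\sum_{a\in\mathbb{F}_q}(x+a)^n=g_{n,q}(x^q-x)$. A permutation polynomial of a finite field $\mathbb{F}$ is a polynomial inducing a bijection of $\mathbb{F}$. $\mathrm{Tr}_{q^e/q}(x)=x+x^q+\cdots+x^{q^{e-1}}$, regarded as a polynomial.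
   Formalization: The displayed identity fails as polynomials (q=4, e=1, n=13: g=x but the display is x^4); it is replaced by the exact identity with first summand x^(q^e) in place of x, and the display is asserted modulo x^(q^e)-x. *)

theory Defs
  imports "Berlekamp_Zassenhaus.Finite_Field" "HOL-Number_Theory.Cong"
begin

text \<open>
  The prime field \<open>\<bbbF>\<^sub>p\<close> is \<open>'p mod_ring\<close> with \<open>CARD('p) = p\<close>, and a field with
  \<open>q\<close> elements is a type of class \<open>{field, finite}\<close> with cardinality \<open>q\<close>.
\<close>

text \<open>
  Extension of scalars \<open>\<bbbF>\<^sub>p[x] \<rightarrow> K[x]\<close>. The coefficient map \<open>\<bbbF>\<^sub>p \<rightarrow> K\<close> goes through the
  integer representative in \<open>{0..<p}\<close>; it is the field embedding when \<open>K\<close> has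
  characteristic \<open>p\<close>, and is only meant to be used in that case.
\<close>
definition base_change :: "'p::prime_card mod_ring poly \<Rightarrow> 'k::field poly" where
  "base_change f = map_poly (\<lambda>c. of_int (to_int_mod_ring c)) f"

text \<open>
  \<open>g_poly TYPE('k) n\<close> is \<open>g\<^bsub>n,q\<^esub> \<in> \<bbbF>\<^sub>p[x]\<close> for \<open>\<bbbF>\<^sub>q = 'k\<close>, \<open>q = CARD('k)\<close> a power of \<open>p\<close>.
  The defining equation is an identity in \<open>\<bbbF>\<^sub>q[x]\<close>; \<open>[:a, 1:]\<close> is \<open>x + a\<close>.
\<close>
definition g_poly :: "'k::{field,finite} itself \<Rightarrow> nat \<Rightarrow> 'p::prime_card mod_ring poly" where
  "g_poly _ n = (THE g. (\<Sum>a\<in>(UNIV :: 'k set). [:a, 1:] ^ n)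
                        = pcompose (base_change g) (monom 1 CARD('k) - monom 1 1))"

text \<open>\<open>trace_poly q e\<close> is \<open>Tr\<^bsub>q^e/q\<^esub>(x) = x + x^q + \<dots> + x^(q^(e-1))\<close>, as a polynomial.\<close>
definition trace_poly :: "nat \<Rightarrow> nat \<Rightarrow> 'a::comm_semiring_1 poly" where
  "trace_poly q e = (\<Sum>i<e. monom 1 (q ^ i))"

definition permutation_poly :: "'l::{field,finite} poly \<Rightarrow> bool" where
  "permutation_poly f \<longleftrightarrow> bij (poly f)"

end

theory Submission
  imports Defs
begin

text \<open>
  In characteristic 2 one has \<open>(x + a)\<^sup>n = (x + a)\<^sup>q\<^sup>-\<^sup>1 (A + a\<^sup>q\<^sup>/\<^sup>2) (B + a\<^sup>q\<^sup>/\<^sup>2)\<close>, where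
  \<open>A\<close> and \<open>B\<close> are the powers of \<open>x\<close> with exponents \<open>q ^ e div 2\<close> and \<open>q * q ^ e div 2\<close>.
  Lagrange interpolation gives \<open>\<Sum>\<^sub>a a\<^sup>k (x + a)\<^sup>q\<^sup>-\<^sup>1 = x\<^sup>k\<close> for \<open>k < q - 1\<close>, which evaluates the
  sum over \<open>a\<close>; composing the claimed polynomial with \<open>x\<^sup>q - x\<close> gives the same result
  because the trace telescopes.

  For the permutation property, the square of the induced map \<open>f\<close> is
  \<open>f(x)\<^sup>2 = x\<^sup>2 + t\<^sup>2 + x t\<close> with \<open>t = Tr(x)\<close>. For odd \<open>e\<close> the trace fixes \<open>\<bbbF>\<^sub>q\<close>, hence
  \<open>Tr(f(x)\<^sup>2) = t\<^sup>2\<close>. So \<open>f(x) = f(y)\<close> forces \<open>x\<close> and \<open>y\<close> to have the same trace \<open>t\<close>, and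
  \<open>d = x + y\<close> satisfies \<open>d (d + t) = 0\<close> and \<open>Tr(d) = 0\<close>; as \<open>Tr(t) = t\<close>, this leaves only \<open>d = 0\<close>.
\<close>

section \<open>Power identities and interpolation in finite fields\<close>

lemma CHAR_finite_field_power:
  assumes "CARD('a::{field,finite}) = p ^ k" and "prime p"
  shows "CHAR('a) = p"
proof -
  have "CHAR('a) > 0"
    by (rule finite_imp_CHAR_pos) simp
  then have "prime CHAR('a)"
    by (rule prime_CHAR_semidom)
  moreover have "CHAR('a) dvd p ^ k"
    using CHAR_dvd_CARD[where 'a='a] assms(1) by simp
  ultimately show ?thesis
    using assms(2) prime_dvd_power_nat primes_dvd_imp_eq by blast
qed

text \<open>Multiplication by \<open>x\<close> permutes the nonzero elements, so their nonzero
  product can be cancelled.\<close>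

lemma field_power_card_minus_one:
  fixes x :: "'a::{field,finite}"
  assumes "x \<noteq> 0"
  shows "x ^ (CARD('a) - 1) = 1"
proof -
  have "x ^ (CARD('a) - 1) * \<Prod>(UNIV - {0}) = (\<Prod>y\<in>UNIV-{0}. x * y)"
    by (simp add: prod.distrib)
  also have "\<dots> = \<Prod>(UNIV - {0})"
    by (rule prod.reindex_bij_witness[of _ "\<lambda>y. y / x" "\<lambda>y. x * y"]) (use assms in auto)
  finally show ?thesis
    by simp
qed

lemma field_power_card_power:
  fixes x :: "'a::{field,finite}"
  shows "x ^ (CARD('a) ^ i) = x"
proof -
  have card: "x ^ CARD('a) = x" for x :: 'a
  proof (cases "x = 0")
    case False
    have "x ^ CARD('a) = x * x ^ (CARD('a) - 1)"
      by (simp flip: power_Suc)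
    then show ?thesis
      using field_power_card_minus_one[OF False] by simp
  qed simp
  show ?thesis
    by (induction i) (simp_all add: card power_mult)
qed

text \<open>The interpolant of \<open>a ^ k\<close> and the monomial itself have degree below the
  number of field elements and agree everywhere, so they coincide. The case \<open>k = 0\<close>
  relies on \<open>0 ^ 0 = 1\<close>.\<close>

lemma sum_power_card_minus_one:
  assumes "k < CARD('a::{field,finite}) - 1"
  shows "(\<Sum>a\<in>(UNIV::'a set). smult (a ^ k) ([:-a, 1:] ^ (CARD('a) - 1))) = - monom 1 k"
proof -
  define N where "N = CARD('a) - 1"
  have N: "N > 0" "k < N" "CARD('a) = Suc N"
    using assms by (auto simp: N_def)
  \<comment> \<open>Lagrange interpolation: \<open>1 - (x - a)\<^sup>N\<close> is the indicator of \<open>a\<close>.\<close>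
  define P where "P = (\<Sum>a\<in>(UNIV::'a set). smult (a ^ k) (1 - [:-a, 1:] ^ N))"
  have deg: "degree (1 - [:-a, 1:] ^ N) \<le> N" for a :: 'a
    by (intro degree_diff_le) (auto simp: degree_linear_power)
  have "degree P \<le> N"
    unfolding P_def by (intro degree_sum_le order_trans[OF degree_smult_le] deg) auto
  moreover have "poly P x = poly (monom 1 k) x" for x
  proof -
    have "poly (smult (a ^ k) (1 - [:-a, 1:] ^ N)) x = (if a = x then a ^ k else 0)" for a
    proof (cases "a = x")
      case False
      then have "(x - a) ^ N = 1"
        unfolding N_def by (intro field_power_card_minus_one) simp
      then show ?thesis
        using False by simp
    qed (use N in simp)
    then have "poly P x = (\<Sum>a\<in>UNIV. if a = x then a ^ k else 0)"
      unfolding P_def poly_sum by simp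
    then show ?thesis
      by (simp add: poly_monom)
  qed
  ultimately have P: "P = monom 1 k"
    by (intro poly_eqI_degree[of UNIV]) (use N in \<open>auto simp: degree_monom_eq\<close>)
  \<comment> \<open>Since \<open>k < N\<close>, the coefficient of \<open>monom 1 k\<close> at
    \<open>N\<close> is zero. So the power sum vanishes, and with it the contribution of the summand
    1 in \<open>1 - [:-a, 1:] ^ N\<close>.\<close>
  have "coeff P N = - (\<Sum>a\<in>(UNIV::'a set). a ^ k)"
    unfolding P_def coeff_sum using N by (simp add: coeff_linear_power sum_negf)
  then have "(\<Sum>a\<in>(UNIV::'a set). a ^ k) = 0"
    using N unfolding P by simp
  moreover have "P = smult (\<Sum>a\<in>(UNIV::'a set). a ^ k) 1 - (\<Sum>a\<in>(UNIV::'a set). smult (a ^ k) ([:-a, 1:] ^ N))"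
    by (simp only: P_def smult_diff_right sum_subtractf smult_sum)
  ultimately show ?thesis
    using P by (simp add: N_def minus_equation_iff)
qed

section \<open>Composition, Frobenius, and base change from the prime field\<close>

lemma pcompose_power: "pcompose (p ^ m) q = pcompose p q ^ m"
  for p q :: "'a::comm_semiring_1 poly"
  by (induction m) (simp_all add: pcompose_1 pcompose_mult)

lemma pcompose_monom_one: "pcompose (monom 1 m) p = p ^ m"
  for p :: "'a::comm_semiring_1 poly"
  by (induction m) (simp_all add: monom_Suc pcompose_pCons pcompose_1 one_pCons monom_0)

lemma add_power_CHAR_2:
  fixes x y :: "'a::comm_ring_1"
  assumes "CHAR('a) = 2"
  shows "(x + y) ^ (2 ^ m) = x ^ (2 ^ m) + y ^ (2 ^ m)"
  by (rule freshmans_dream') (simp_all add: assms)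

text \<open>Representatives add and multiply up to reduction modulo \<open>CARD('p)\<close>, which
  \<open>of_int\<close> does not see in this characteristic.\<close>

lemma comm_ring_hom_mod_ring:
  assumes "CHAR('k::field) = CARD('p::prime_card)"
  shows "comm_ring_hom (\<lambda>c::'p mod_ring. of_int (to_int_mod_ring c) :: 'k)"
proof
  fix x y :: "'p mod_ring"
  have mod: "of_int (a mod int CARD('p)) = (of_int a :: 'k)" for a
    using of_int_mod_CHAR[where 'a='k] assms by metis
  show "of_int (to_int_mod_ring (x + y)) = (of_int (to_int_mod_ring x) + of_int (to_int_mod_ring y) :: 'k)"
    by (simp add: to_int_mod_ring_add mod)
  show "of_int (to_int_mod_ring (x * y)) = (of_int (to_int_mod_ring x) * of_int (to_int_mod_ring y) :: 'k)"
    by (simp add: to_int_mod_ring_mult mod)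
qed simp_all

lemma base_change_inj:
  assumes "CHAR('k::field) = CARD('p::prime_card)"
  shows "inj (base_change :: 'p mod_ring poly \<Rightarrow> 'k poly)"
proof (rule injI)
  fix f g :: "'p mod_ring poly"
  interpret comm_ring_hom "\<lambda>c::'p mod_ring. of_int (to_int_mod_ring c) :: 'k"
    by (rule comm_ring_hom_mod_ring) fact
  interpret field_hom "\<lambda>c::'p mod_ring. of_int (to_int_mod_ring c) :: 'k" ..
  interpret map_poly_inj_zero_hom "\<lambda>c::'p mod_ring. of_int (to_int_mod_ring c) :: 'k" ..
  assume "(base_change f :: 'k poly) = base_change g"
  then show "f = g"
    unfolding base_change_def by simp
qed

text \<open>Composition with a nonconstant polynomial is injective, and so is
  \<open>base_change\<close>. Hence any solution of the defining equation is the one chosen by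
  \<open>THE\<close>.\<close>

lemma g_poly_eqI:
  fixes g :: "'p::prime_card mod_ring poly"
  assumes CHAR: "CHAR('k::{field,finite}) = CARD('p)"
    and eq: "(\<Sum>a\<in>(UNIV :: 'k set). [:a, 1:] ^ n)
      = pcompose (base_change g) (monom 1 CARD('k) - monom 1 1)"
  shows "g_poly TYPE('k) n = g"
  unfolding g_poly_def
proof (rule the_equality)
  fix h :: "'p mod_ring poly"
  let ?Y = "monom 1 CARD('k) - monom 1 1 :: 'k poly"
  assume "(\<Sum>a\<in>(UNIV :: 'k set). [:a, 1:] ^ n) = pcompose (base_change h) ?Y"
  then have "pcompose (base_change h - base_change g) ?Y = 0"
    using eq by (simp add: pcompose_diff)
  moreover have "degree ?Y > 0"
  proof -
    have "CARD('k) > 1"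
      using card_mono[of UNIV "{0, 1 :: 'k}"] by simp
    then have "coeff ?Y 1 \<noteq> 0"
      by simp
    then show ?thesis
      using le_degree by fastforce
  qed
  ultimately have "(base_change h :: 'k poly) = base_change g"
    using pcompose_eq_0 by fastforce
  then show "h = g"
    using base_change_inj[OF CHAR] by (rule injD[rotated])
qed (fact eq)

lemma base_change_g:
  assumes "CHAR('k::field) = CARD('p::prime_card)"
  shows "base_change (monom 1 a + trace_poly q e + monom 1 b * trace_poly q e ^ c :: 'p mod_ring poly)
    = (monom 1 a + trace_poly q e + monom 1 b * trace_poly q e ^ c :: 'k poly)"
proof -
  interpret comm_ring_hom "\<lambda>c::'p mod_ring. of_int (to_int_mod_ring c) :: 'k"
    by (rule comm_ring_hom_mod_ring) fact
  interpret F: map_poly_comm_ring_hom "\<lambda>c::'p mod_ring. of_int (to_int_mod_ring c) :: 'k" ..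
  show ?thesis
    by (simp add: base_change_def trace_poly_def F.hom_add F.hom_mult F.hom_power F.hom_sum)
qed

section \<open>The two sides of the defining equation\<close>

lemma sum_shift_power_explicit:
  fixes q s e n :: nat
  assumes "s > 1" "q = 2 ^ s" "e > 0" "CARD('k::{field,finite}) = q"
    and n: "n = (q - 1) + (q div 2) * q ^ (e - 1) + (q div 2) * q ^ e"
  defines "X \<equiv> \<lambda>m. monom 1 m :: 'k poly"
  defines "A \<equiv> X (q ^ e div 2)" and "B \<equiv> X (q * q ^ e div 2)"
  shows "(\<Sum>a\<in>(UNIV :: 'k set). [:a, 1:] ^ n) = A * B + X (q div 2) * (A + B) + X 1"
proof -
  have CHAR: "CHAR('k) = 2"
    using CHAR_finite_field_power[where 'a='k] assms by simp
  then have CHARp: "CHAR('k poly) = 2"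
    by simp
  have half: "q div 2 = 2 ^ (s - 1)" "2 * (q div 2) = q"
    using assms by (cases s; simp)+
  \<comment> \<open>Interpolation will be applied with exponents 0, \<open>q div 2\<close> and 1;
    here \<open>q div 2 < q - 1\<close> fails for \<open>q = 2\<close>, so \<open>s > 1\<close>
    matters.\<close>
  have "q \<ge> 4"
    using assms power_increasing[of 2 s "2::nat"] by simp
  have exps: "q div 2 * q ^ (e - 1) = 2 ^ (s - 1 + s * (e - 1))" "q div 2 * q ^ e = 2 ^ (s - 1 + s * e)"
    unfolding half by (simp_all add: assms power_add power_mult)
  have exps': "q div 2 * q ^ (e - 1) = q ^ e div 2" "q div 2 * q ^ e = q * q ^ e div 2"
  proof -
    have "q ^ e = 2 * (q div 2 * q ^ (e - 1))"
      using half(2) \<open>e > 0\<close> by (cases e) (simp_all flip: mult.assoc)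
    moreover have "q * q ^ e = 2 * (q div 2 * q ^ e)"
      using half(2) by (metis mult.assoc)
    ultimately show "q div 2 * q ^ (e - 1) = q ^ e div 2" "q div 2 * q ^ e = q * q ^ e div 2"
      by (metis nonzero_mult_div_cancel_left zero_neq_numeral)+
  qed
  have frob: "a ^ (m * q ^ i) = a ^ m" for a :: 'k and m i
    using field_power_card_power[of "a ^ m" i] assms(4) by (simp add: power_mult)
  have shift: "[:a, 1:] ^ (2 ^ m) = X (2 ^ m) + [:a ^ (2 ^ m):]" for a :: 'k and m
  proof -
    have "[:a, 1:] = X 1 + [:a:]"
      by (simp add: X_def monom_altdef)
    then show ?thesis
      by (simp add: add_power_CHAR_2[OF CHARp] X_def monom_power poly_const_pow)
  qed
  define L where "L = (\<lambda>a::'k. [:a, 1:] ^ (q - 1))"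
  have sums: "(\<Sum>a\<in>UNIV. smult (a ^ k) (L a)) = X k" if "k < q - 1" for k
    using sum_power_card_minus_one[where 'a='k] that
    by (simp add: L_def X_def assms(4) uminus_CHAR_2[OF CHAR] uminus_CHAR_2[OF CHARp])
  have "[:a, 1:] ^ n = A * B * smult (a ^ 0) (L a) + (A + B) * smult (a ^ (q div 2)) (L a) + smult (a ^ 1) (L a)"
    for a :: 'k
  proof -
    have "[:a, 1:] ^ (q div 2 * q ^ (e - 1)) = A + [:a ^ (q div 2):]"
      using shift[of a "s - 1 + s * (e - 1)"] frob[of a "q div 2" "e - 1"]
      unfolding exps(1)[symmetric] by (simp only: A_def exps')
    moreover have "[:a, 1:] ^ (q div 2 * q ^ e) = B + [:a ^ (q div 2):]"
      using shift[of a "s - 1 + s * e"] frob[of a "q div 2" "e"]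
      unfolding exps(2)[symmetric] by (simp only: B_def exps')
    \<comment> \<open>The square of \<open>a ^ (q div 2)\<close> is \<open>a ^ q\<close>, so the
      constant term of the product of the two shifted factors is just \<open>a\<close>.\<close>
    moreover have "a ^ (q div 2) * a ^ (q div 2) = a"
      using frob[of a 1 1] half(2) by (simp flip: power_add mult_2)
    ultimately show ?thesis
      unfolding n by (simp add: power_add L_def smult_add_right algebra_simps)
  qed
  then have "(\<Sum>a\<in>(UNIV :: 'k set). [:a, 1:] ^ n)
      = A * B * (\<Sum>a\<in>UNIV. smult (a ^ 0) (L a)) + (A + B) * (\<Sum>a\<in>UNIV. smult (a ^ (q div 2)) (L a))
        + (\<Sum>a\<in>UNIV. smult (a ^ 1) (L a))"
    by (simp only: sum.distrib sum_distrib_left)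
  also have "\<dots> = A * B * X 0 + (A + B) * X (q div 2) + X 1"
    using sums[of 0] sums[of "q div 2"] sums[of 1] \<open>q \<ge> 4\<close> by simp
  finally have "(\<Sum>a\<in>(UNIV :: 'k set). [:a, 1:] ^ n)
      = A * B * X 0 + (A + B) * X (q div 2) + X 1" .
  then show ?thesis
    by (simp add: X_def mult.commute)
qed

text \<open>By Frobenius, the \<open>i\<close>-th summand becomes a difference of consecutive terms
  \<open>monom 1 (q ^ i)\<close>.\<close>

lemma pcompose_trace_poly:
  fixes q s e :: nat
  assumes "CHAR('k::field) = 2" "q = 2 ^ s"
  shows "pcompose (trace_poly q e) (monom 1 q - monom 1 1) = (monom 1 (q ^ e) - monom 1 1 :: 'k poly)"
proof -
  have CHARp: "CHAR('k poly) = 2"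
    using assms by simp
  have "(monom 1 q - monom 1 1 :: 'k poly) ^ (q ^ i) = monom 1 (q ^ Suc i) - monom 1 (q ^ i)" for i
    using add_power_CHAR_2[OF CHARp, of _ _ "s * i"]
    by (simp add: assms(2) minus_CHAR_2[OF CHARp] power_mult monom_power flip: power_add)
  then show ?thesis
    using sum_lessThan_telescope[of "\<lambda>i. monom 1 (q ^ i) :: 'k poly" e]
    by (simp add: trace_poly_def pcompose_sum pcompose_monom_one)
qed

text \<open>The first summand must be \<open>monom 1 (q ^ e)\<close> rather than
  \<open>monom 1 1\<close>: it yields \<open>X (q * q ^ e)\<close>, which cancels the unwanted
  \<open>B * B\<close>.\<close>

lemma pcompose_explicit:
  fixes q s e :: nat
  assumes "s > 0" "q = 2 ^ s" "CHAR('k::field) = 2"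
  defines "X \<equiv> \<lambda>m. monom 1 m :: 'k poly"
  defines "A \<equiv> X (q ^ e div 2)" and "B \<equiv> X (q * q ^ e div 2)"
  assumes "e > 0"
  shows "pcompose (monom 1 (q ^ e) + trace_poly q e + monom 1 (q ^ e div 2) * trace_poly q e ^ (q div 2))
      (X q - X 1) = A * B + X (q div 2) * (A + B) + X 1"
proof -
  have CHARp: "CHAR('k poly) = 2"
    using assms by simp
  \<comment> \<open>\<open>B\<close> arises twice, as \<open>A ^ q\<close> and as
    \<open>X (q ^ e) ^ (q div 2)\<close>; hence the two factorizations of its exponent.\<close>
  have exps: "q ^ e = 2 ^ (s * e)" "q ^ e div 2 = 2 ^ (s * e - 1)" "q div 2 = 2 ^ (s - 1)"
    "q * q ^ e div 2 = q * (q ^ e div 2)" "q * q ^ e div 2 = q ^ e * (q div 2)"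
    using assms by (auto simp: power_mult[symmetric] power_diff div_mult_swap power_diff mult.commute)
  have pow: "(x - y) ^ 2 ^ m = x ^ 2 ^ m + y ^ 2 ^ m" for x y :: "'k poly" and m
    unfolding minus_CHAR_2[OF CHARp] by (rule add_power_CHAR_2[OF CHARp])
  have "(X q - X 1) ^ (q ^ e) = X (q * q ^ e) + X (q ^ e)"
    unfolding exps(1) pow by (simp add: X_def monom_power)
  moreover have "(X q - X 1) ^ (q ^ e div 2) = B + A"
    unfolding A_def B_def exps(4) unfolding exps(2) pow by (simp add: X_def monom_power)
  moreover have "(X (q ^ e) - X 1) ^ (q div 2) = B + X (q div 2)"
    unfolding B_def exps(5) unfolding exps(3) pow by (simp add: X_def monom_power)
  moreover have "pcompose (trace_poly q e) (X q - X 1) = X (q ^ e) - X 1"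
    unfolding X_def by (rule pcompose_trace_poly) fact+
  ultimately have "pcompose (monom 1 (q ^ e) + trace_poly q e + monom 1 (q ^ e div 2) * trace_poly q e ^ (q div 2))
      (X q - X 1) = (X (q * q ^ e) + X (q ^ e)) + (X (q ^ e) - X 1) + (B + A) * (B + X (q div 2))"
    by (simp add: pcompose_add pcompose_mult pcompose_monom_one pcompose_power)
  also have "\<dots> = A * B + X (q div 2) * (A + B) + X 1 + (X (q * q ^ e) + B * B) + (X (q ^ e) + X (q ^ e))"
    by (simp add: minus_CHAR_2[OF CHARp] algebra_simps)
  also have "B * B = X (q * q ^ e)"
    using assms by (auto simp: B_def X_def mult_monom simp flip: mult_2)
  finally show ?thesis
    using of_nat_CHAR[where 'a="'k poly"] CHARp by simp
qed

section \<open>The permutation property\<close>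

text \<open>Raising to the power \<open>q\<close> shifts the summands cyclically, because
  \<open>x ^ (q ^ e) = x\<close>.\<close>

lemma poly_trace_poly_power:
  fixes q s e :: nat and x :: "'l::{field,finite}"
  assumes "CHAR('l) = 2" "q = 2 ^ s" "CARD('l) = q ^ e"
  defines "T \<equiv> poly (trace_poly q e)"
  shows "T x ^ q = T x"
proof -
  have "T x ^ q = (\<Sum>i<e. x ^ (q ^ Suc i))"
    unfolding T_def trace_poly_def poly_sum poly_monom
    by (subst freshmans_dream_sum') (auto simp: assms(1,2) add.commute simp flip: power_mult power_add)
  moreover have "x ^ (q ^ e) = x"
    using field_power_card_power[of x 1] assms(3) by simp
  ultimately show ?thesis
    using sum.lessThan_Suc_shift[of "\<lambda>i. x ^ (q ^ i)" e] sum.lessThan_Suc[of "\<lambda>i. x ^ (q ^ i)" e]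
    by (simp add: T_def trace_poly_def poly_sum poly_monom)
qed

lemma permutation_poly_explicit:
  fixes q s e :: nat
  assumes "s > 0" "q = 2 ^ s" "CARD('l::{field,finite}) = q ^ e" "odd e"
  shows "permutation_poly (monom 1 (q ^ e) + trace_poly q e
    + monom 1 (q ^ e div 2) * trace_poly q e ^ (q div 2) :: 'l poly)"
    (is "permutation_poly ?f")
proof -
  have "CARD('l) = 2 ^ (s * e)"
    by (simp add: assms power_mult)
  then have CHAR: "CHAR('l) = 2"
    using CHAR_finite_field_power[where 'a='l] by simp
  define T where "T = poly (trace_poly q e :: 'l poly)"
  have T: "T x = (\<Sum>i<e. x ^ (q ^ i))" for x
    by (simp add: T_def trace_poly_def poly_sum poly_monom)
  have T_q: "T x ^ q = T x" for x
    unfolding T_def using poly_trace_poly_power CHAR assms by blast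
  have frob: "c ^ (q ^ i) = c" if "c ^ q = c" for c :: 'l and i
    using that by (induction i) (simp_all add: power_mult)
  have dbl: "x + x = 0" for x :: 'l
    using minus_CHAR_2[OF CHAR, of x x] by simp
  have T_add: "T (x + y) = T x + T y" for x y
    by (simp add: T assms(2) add_power_CHAR_2[OF CHAR] sum.distrib flip: power_mult)
  have T_scale: "T (c * x) = c * T x" if "c ^ q = c" for c x
    by (simp add: T power_mult_distrib frob[OF that] sum_distrib_left)
  have T_const: "T c = c" if "c ^ q = c" for c
  proof -
    have "T c = of_nat e * c"
      by (simp add: T frob[OF that])
    \<comment> \<open>An odd number of ones sums to 1 in characteristic 2.\<close>
    also have "of_nat e = (1 :: 'l)"
      using \<open>odd e\<close> by (auto elim!: oddE simp: dbl mult_2)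
    finally show ?thesis
      by simp
  qed
  have sq_add: "(x + y)\<^sup>2 = x\<^sup>2 + y\<^sup>2" for x y :: 'l
    using add_power_CHAR_2[OF CHAR, of x y 1] by simp
  have T_sq: "T (x\<^sup>2) = (T x)\<^sup>2" for x
    unfolding T by (subst freshmans_dream_sum[where n=2]) (simp_all add: CHAR mult.commute flip: power_mult)
  have Q: "x ^ (q ^ e) = x" for x :: 'l
    using field_power_card_power[of x 1] assms(3) by simp
  have even: "even q" "even (q ^ e)"
    using assms by (auto simp: odd_pos)
  have f_sq: "(poly ?f x)\<^sup>2 = x\<^sup>2 + (T x)\<^sup>2 + x * T x" for x
  proof -
    \<comment> \<open>Squaring undoes both halved exponents, leaving \<open>x ^ (q ^ e)\<close> and
      \<open>T x ^ q\<close>.\<close>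
    have "(x ^ (q ^ e div 2) * T x ^ (q div 2))\<^sup>2 = x * T x"
      using even by (simp add: power_mult_distrib Q T_q flip: power_mult)
    then show ?thesis
      by (simp add: poly_monom Q sq_add flip: T_def)
  qed
  have T_f_sq: "T ((poly ?f x)\<^sup>2) = (T x)\<^sup>2" for x
  proof -
    have "T (x * T x) = T x * T x"
      using T_scale[OF T_q, of x x] by (simp add: mult.commute)
    then have "T ((poly ?f x)\<^sup>2) = (T x)\<^sup>2 + (T x)\<^sup>2 + T x * T x"
      by (simp only: f_sq T_add T_sq T_const[OF T_q])
    then show ?thesis
      by (simp add: dbl power2_eq_square)
  qed
  have sq_inj: "x = y" if "x\<^sup>2 = y\<^sup>2" for x y :: 'l
    using that by (auto simp: power2_eq_iff uminus_CHAR_2[OF CHAR])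
  have "inj (poly ?f)"
  proof (rule injI)
    fix x y
    assume eq: "poly ?f x = poly ?f y"
    then have tr: "T x = T y"
      using T_f_sq sq_inj by metis
    define d where "d = x + y"
    have Td: "T d = 0"
      by (simp add: d_def T_add tr dbl)
    have "x\<^sup>2 + (T x)\<^sup>2 + x * T x = y\<^sup>2 + (T x)\<^sup>2 + y * T x"
      using f_sq[of x] f_sq[of y] eq tr by metis
    then have "x\<^sup>2 + x * T x = y\<^sup>2 + y * T x"
      by (simp add: algebra_simps)
    then have "(x\<^sup>2 + x * T x) + (y\<^sup>2 + y * T x) = 0"
      by (simp only: dbl)
    then have "d\<^sup>2 + d * T x = 0"
      by (simp add: d_def sq_add algebra_simps)
    then have "d * (d + T x) = 0"
      by (simp add: power2_eq_square distrib_left)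
    \<comment> \<open>Applying \<open>T\<close> to \<open>d + T x = 0\<close> leaves
      \<open>T x = 0\<close>, so the second factor also forces \<open>d = 0\<close>.\<close>
    moreover have "T x = 0" if "d + T x = 0"
    proof -
      have "T 0 = 0"
        by (metis T_add dbl)
      then show ?thesis
        using T_add[of d "T x"] that Td T_const[OF T_q, of x] by simp
    qed
    ultimately have "d = 0"
      by auto
    then show "x = y"
      using minus_CHAR_2[OF CHAR, of x y] by (simp add: d_def)
  qed
  then show ?thesis
    unfolding permutation_poly_def bij_def using finite_UNIV_inj_surj[OF finite] by blast
qed

text \<open>The exact identity has first summand \<open>monom 1 (q ^ e)\<close>. The form with
  \<open>x\<close> differs from it by \<open>monom 1 (q ^ e) - monom 1 1\<close>, which is nonzero
  but vanishes at every point of the field with \<open>q ^ e\<close> elements; hence the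
  congruence.\<close>

theorem theorem6p9:
  fixes q s e n :: nat
    and g :: "'p::prime_card mod_ring poly"
  assumes "CARD('p) = 2"
    and "s > 1"
    and "q = 2 ^ s"
    and "e > 0"
    and "CARD('k::{field,finite}) = q"
    and "n = (q - 1) * q ^ 0 + (q div 2) * q ^ (e - 1) + (q div 2) * q ^ e"
    and "g = g_poly TYPE('k) n"
  shows "g = monom 1 (q ^ e) + trace_poly q e
             + monom 1 (q ^ e div 2) * trace_poly q e ^ (q div 2)
       \<and> [g = monom 1 1 + trace_poly q e
             + monom 1 (q ^ e div 2) * trace_poly q e ^ (q div 2)] (mod (monom 1 (q ^ e) - monom 1 1))
       \<and> (odd e \<longrightarrow> CARD('l::{field,finite}) = q ^ e
            \<longrightarrow> permutation_poly (base_change g :: 'l poly))"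
proof -
  let ?G = "monom 1 (q ^ e) + trace_poly q e
    + monom 1 (q ^ e div 2) * trace_poly q e ^ (q div 2) :: 'p mod_ring poly"
  have CHAR: "CHAR('k) = 2"
    using CHAR_finite_field_power[where 'a='k] assms by simp
  have "(\<Sum>a\<in>(UNIV :: 'k set). [:a, 1:] ^ n)
      = pcompose (base_change ?G) (monom 1 CARD('k) - monom 1 1)"
    using sum_shift_power_explicit[where 'k='k, of s q e n] pcompose_explicit[where 'k='k, of s q e] assms(1-6) CHAR
    by (simp add: base_change_g)
  then have g: "g = ?G"
    using g_poly_eqI[where 'k='k, of n ?G] assms CHAR by simp
  moreover have "[?G = monom 1 1 + trace_poly q e
      + monom 1 (q ^ e div 2) * trace_poly q e ^ (q div 2)] (mod (monom 1 (q ^ e) - monom 1 1))"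
    by (intro cong_add cong_refl) (simp add: cong_iff_dvd_diff)
  moreover have "permutation_poly (base_change g :: 'l poly)" if "odd e" "CARD('l) = q ^ e"
  proof -
    have "CARD('l) = 2 ^ (s * e)"
      using that(2) assms by (simp add: power_mult)
    then have "CHAR('l) = CARD('p)"
      using CHAR_finite_field_power[where 'a='l] assms(1) by simp
    then show ?thesis
      using permutation_poly_explicit[where 'l='l, of s q e] that assms(2,3)
      by (simp add: g base_change_g)
  qed
  ultimately show ?thesis
    by blast
qed

end
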